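(* Let $\{U_g: g\in G\}$ be a representation of a finite group $G$ of order $N$ acting by (linear) isometries on the real inner product space $\mathcal{V}$ of dimension $d$. Let $V_G=\{x\in\mathcal{V}: U_gx=x\ \ \forall g\in G\}$ and $d_G=\dim(V_G)$. Let $\mathbf{w}\in\mathcal{V}^p$ and $S\subset[N]\times[p]$, $|S|=m$, be such that $\widehat{\Phi}_{\mathbf{w},S}:\widehat{\mathcal{V}}\to\mathbb{R}^m$ is injective on the quotient space $\widehat{\mathcal{V}}$. Then, for a generic linear map $\ell:\mathbb{R}^m\to\mathbb{R}^{2d-d_G}$, the map $\widehat{\Psi}_{\mathbf{w},S,\ell}=\ell\circ\widehat{\Phi}_{\mathbf{w},S}:\widehat{\mathcal{V}}\to\mathbb{R}^{2d-d_G}$ is injective and bi-Lipschitz.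
   Context: $(\mathcal{V},\langle\cdot,\cdot\rangle)$ is a real inner product space of finite dimension $d\ge 2$, and $g\mapsto U_g$ is a homomorphism from $G$ ($|G|=N$) into the group of linear isometries of $\mathcal{V}$. The orbit of $x$ is $[x]=\{U_gx: g\in G\}$, $\widehat{\mathcal{V}}=\mathcal{V}/G$ is the set of orbits, with metric $\mathbf{d}([x],[y])=\min_{g\in G}\|x-U_gy\|$. For $n\in\mathbb{N}$, $[n]=\{1,\dots,n\}$. For $i\in[p]$ and $j\in[N]$, $\Phi_{w_i,j}(x)$ is the $j$-th coordinate of the vector obtained by sorting the $N$ numbers $(\langle U_gw_i,x\rangle)_{g\in G}$ (with repetitions) in decreasing order. With $S_i=\{k\in[N]:(k,i)\in S\}$, the coorbit embedding is $$\Phi_{\mathbf{w},S}:\mathcal{V}\to\mathbb{R}^m,\qquad \Phi_{\mathbf{w},S}(x)=\big[\{\Phi_{w_1,j}(x)\}_{j\in S_1},\dots,\{\Phi_{w_p,j}(x)\}_{j\in S_p}\big].$$ It is $G$-invariant, and $\widehat{\Phi}_{\mathbf{w},S}([x])=\Phi_{\mathbf{w},S}(x)$ is the induced map on $\widehat{\mathcal{V}}$. A map $f:\widehat{\mathcal{V}}\to\mathbb{R}^q$ is bi-Lipschitz if there are $0<a\le b<\infty$ with $a\,\mathbf{d}([x],[y])\le\|f([x])-f([y])\|_2\le b\,\mathbf{d}([x],[y])$ for all $x,y$. "Generic" means: for all $\ell$ in an open dense set with respect to the Zariski topology on the space of $(2d-d_G)\times m$ real matrices. *)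

theory Defs
  imports "HOL-Analysis.Analysis" "HOL-Algebra.Coset"
begin

definition linear_isometries :: "('a::euclidean_space \<Rightarrow> 'a) monoid" where
  "linear_isometries =
     \<lparr>carrier = {f. linear f \<and> (\<forall>x. norm (f x) = norm x)}, mult = (\<circ>), one = id\<rparr>"

definition fixed_space :: "('g, 'b) monoid_scheme \<Rightarrow> ('g \<Rightarrow> 'a \<Rightarrow> 'a) \<Rightarrow> 'a set" where
  "fixed_space G U = {x. \<forall>g\<in>carrier G. U g x = x}"

definition orbit :: "('g, 'b) monoid_scheme \<Rightarrow> ('g \<Rightarrow> 'a \<Rightarrow> 'a) \<Rightarrow> 'a \<Rightarrow> 'a set" where
  "orbit G U x = {U g x | g. g \<in> carrier G}"

definition orbit_space :: "('g, 'b) monoid_scheme \<Rightarrow> ('g \<Rightarrow> 'a \<Rightarrow> 'a) \<Rightarrow> 'a set set" where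
  "orbit_space G U = range (orbit G U)"

(* The map induced on orbits by an invariant function f: the common value of f on the orbit X.
   See lemma orbit_lift_orbit. *)
definition orbit_lift :: "('a \<Rightarrow> 'c) \<Rightarrow> 'a set \<Rightarrow> 'c" where
  "orbit_lift f X = the_elem (f ` X)"

(* The minimum depends only on the orbits of x and y, so it descends to pairs of orbits.
   See lemma orbit_dist_orbit. *)
definition orbit_dist ::
    "('g, 'b) monoid_scheme \<Rightarrow> ('g \<Rightarrow> 'a \<Rightarrow> 'a::real_inner) \<Rightarrow> 'a set \<Rightarrow> 'a set \<Rightarrow> real" where
  "orbit_dist G U X Y =
     the_elem ((\<lambda>(x, y). Min {norm (x - U g y) | g. g \<in> carrier G}) ` (X \<times> Y))"

(* The index j is 1-based; the sorted list has length card (carrier G). *)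
definition coorbit ::
    "('g, 'b) monoid_scheme \<Rightarrow> ('g \<Rightarrow> 'a \<Rightarrow> 'a::real_inner) \<Rightarrow> 'a \<Rightarrow> nat \<Rightarrow> 'a \<Rightarrow> real" where
  "coorbit G U w j x =
     rev (sorted_list_of_multiset (image_mset (\<lambda>g. U g w \<bullet> x) (mset_set (carrier G)))) ! (j - 1)"

(* The bijection e from 'm to S labels the m = card S coordinates of the target space by the
   pairs (j, i) in S; listing S block by block in i is one such labelling. *)
definition coorbit_map ::
    "('g, 'b) monoid_scheme \<Rightarrow> ('g \<Rightarrow> 'a \<Rightarrow> 'a::real_inner) \<Rightarrow> (nat \<Rightarrow> 'a) \<Rightarrow>
      ('m::finite \<Rightarrow> nat \<times> nat) \<Rightarrow> 'a \<Rightarrow> real ^ 'm" where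
  "coorbit_map G U w e x = (\<chi> k. case e k of (j, i) \<Rightarrow> coorbit G U (w i) j x)"

definition bi_lipschitz ::
    "('g, 'b) monoid_scheme \<Rightarrow> ('g \<Rightarrow> 'a \<Rightarrow> 'a::real_inner) \<Rightarrow>
      ('a set \<Rightarrow> 'c::real_normed_vector) \<Rightarrow> bool" where
  "bi_lipschitz G U f \<longleftrightarrow>
     (\<exists>a b. 0 < a \<and> a \<le> b \<and>
        (\<forall>X\<in>orbit_space G U. \<forall>Y\<in>orbit_space G U.
           a * orbit_dist G U X Y \<le> norm (f X - f Y) \<and>
           norm (f X - f Y) \<le> b * orbit_dist G U X Y))"

(* On a Euclidean space, real_polynomial_function describes the polynomials in the coordinates
   (for matrices: in the entries). *)
definition zariski_open :: "'c::euclidean_space set \<Rightarrow> bool" where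
  "zariski_open O' \<longleftrightarrow>
     (\<exists>P. (\<forall>p\<in>P. real_polynomial_function p) \<and> - O' = {x. \<forall>p\<in>P. p x = 0})"

definition zariski :: "'c::euclidean_space topology" where
  "zariski = topology zariski_open"

definition zariski_generic :: "('c::euclidean_space \<Rightarrow> bool) \<Rightarrow> bool" where
  "zariski_generic Q \<longleftrightarrow>
     (\<exists>O'. openin zariski O' \<and> Abstract_Topology.closure_of zariski O' = UNIV \<and> (\<forall>x\<in>O'. Q x))"

lemma zariski_openI:
  "(\<And>p. p \<in> P \<Longrightarrow> real_polynomial_function p) \<Longrightarrow> - O' = {x. \<forall>p\<in>P. p x = 0} \<Longrightarrow>
    zariski_open O'"
  unfolding zariski_open_def by blast

lemma zariski_open_Int:
  assumes "zariski_open A" "zariski_open B"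
  shows "zariski_open (A \<inter> B)"
proof -
  obtain P where P: "\<forall>p\<in>P. real_polynomial_function p" "- A = {x. \<forall>p\<in>P. p x = 0}"
    using assms(1) unfolding zariski_open_def by (elim exE conjE)
  obtain Q where Q: "\<forall>q\<in>Q. real_polynomial_function q" "- B = {x. \<forall>q\<in>Q. q x = 0}"
    using assms(2) unfolding zariski_open_def by (elim exE conjE)
  define R where "R = (\<lambda>(p, q) x. p x * q x) ` (P \<times> Q)"
  show ?thesis
  proof (rule zariski_openI)
    show "real_polynomial_function r" if "r \<in> R" for r
      using that P(1) Q(1) unfolding R_def by (auto intro: real_polynomial_function.intros(4))
    have "- (A \<inter> B) = - A \<union> - B" by (rule Compl_Int)
    then show "- (A \<inter> B) = {x. \<forall>r\<in>R. r x = 0}"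
      unfolding P(2) Q(2) R_def by auto
  qed
qed

lemma zariski_open_Union:
  assumes "\<forall>A\<in>K. zariski_open A"
  shows "zariski_open (\<Union>K)"
proof -
  obtain P where P: "\<forall>A\<in>K. (\<forall>p\<in>P A. real_polynomial_function p) \<and> - A = {x. \<forall>p\<in>P A. p x = 0}"
    using bchoice[OF assms[unfolded zariski_open_def]] by (elim exE)
  show ?thesis
  proof (rule zariski_openI)
    show "real_polynomial_function p" if "p \<in> (\<Union>A\<in>K. P A)" for p
      using that P by auto
    have "- \<Union>K = (\<Inter>A\<in>K. - A)" by blast
    also have "\<dots> = (\<Inter>A\<in>K. {x. \<forall>p\<in>P A. p x = 0})"
      using P by (intro INF_cong) auto
    finally show "- \<Union>K = {x. \<forall>p\<in>(\<Union>A\<in>K. P A). p x = 0}" by auto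
  qed
qed

lemma openin_zariski: "openin zariski = zariski_open"
  unfolding zariski_def
  by (rule topology_inverse') (simp add: istopology_def zariski_open_Int zariski_open_Union)

lemma topspace_zariski [simp]: "topspace zariski = UNIV"
proof -
  have "zariski_open UNIV"
    by (rule zariski_openI[of "{\<lambda>_. 1}"]) (auto intro: real_polynomial_function.intros(2))
  then show ?thesis
    using openin_subset[of zariski UNIV] by (auto simp: openin_zariski)
qed

lemma orbit_lift_orbit:
  assumes "group G" and "\<And>g x. g \<in> carrier G \<Longrightarrow> f (U g x) = f x"
  shows "orbit_lift f (orbit G U x) = f x"
proof -
  have "\<one>\<^bsub>G\<^esub> \<in> carrier G"
    using assms(1) by (simp add: group.is_monoid monoid.one_closed)
  then have "orbit G U x \<noteq> {}" unfolding orbit_def by blast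
  then show ?thesis
    unfolding orbit_lift_def
    by (rule the_elem_image_unique) (use assms(2) in \<open>auto simp: orbit_def\<close>)
qed

context
  fixes G :: "('g, 'b) monoid_scheme" and U :: "'g \<Rightarrow> 'a \<Rightarrow> 'a::euclidean_space"
  assumes grp: "group G" and U_hom: "U \<in> hom G linear_isometries"
begin

interpretation group G by (rule grp)

lemma rep_mult: "g \<in> carrier G \<Longrightarrow> h \<in> carrier G \<Longrightarrow> U (g \<otimes>\<^bsub>G\<^esub> h) x = U g (U h x)"
  using U_hom by (simp add: hom_def linear_isometries_def)

lemma rep_linear: "g \<in> carrier G \<Longrightarrow> linear (U g)"
  using U_hom by (auto simp: hom_def linear_isometries_def)

lemma rep_norm: "g \<in> carrier G \<Longrightarrow> norm (U g x) = norm x"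
  using U_hom by (auto simp: hom_def linear_isometries_def)

lemma rep_one: "U \<one>\<^bsub>G\<^esub> x = x"
proof -
  have "U \<one>\<^bsub>G\<^esub> (U \<one>\<^bsub>G\<^esub> x - x) = 0"
    using rep_mult[of "\<one>\<^bsub>G\<^esub>" "\<one>\<^bsub>G\<^esub>" x] by (simp add: linear_diff rep_linear)
  then show ?thesis
    using rep_norm[of "\<one>\<^bsub>G\<^esub>" "U \<one>\<^bsub>G\<^esub> x - x"] by simp
qed

lemma rep_inner: "g \<in> carrier G \<Longrightarrow> U g x \<bullet> U g y = x \<bullet> y"
  using orthogonal_transformation[of "U g"] rep_linear rep_norm
  by (auto simp: orthogonal_transformation_def)

lemma rep_inner_left:
  assumes "g \<in> carrier G"
  shows "x \<bullet> U g y = U (inv\<^bsub>G\<^esub> g) x \<bullet> y"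
proof -
  have "x = U g (U (inv\<^bsub>G\<^esub> g) x)"
    using rep_mult[of g "inv\<^bsub>G\<^esub> g" x] assms by (simp add: rep_one)
  then have "x \<bullet> U g y = U g (U (inv\<^bsub>G\<^esub> g) x) \<bullet> U g y" by simp
  also have "\<dots> = U (inv\<^bsub>G\<^esub> g) x \<bullet> y" using assms by (rule rep_inner)
  finally show ?thesis .
qed

lemma bij_betw_left: "h \<in> carrier G \<Longrightarrow> bij_betw (\<lambda>g. h \<otimes>\<^bsub>G\<^esub> g) (carrier G) (carrier G)"
  by (rule bij_betw_byWitness[where f' = "\<lambda>g. inv\<^bsub>G\<^esub> h \<otimes>\<^bsub>G\<^esub> g"])
    (auto simp: m_assoc[symmetric])

lemma coorbit_invariant:
  assumes h: "h \<in> carrier G"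
  shows "coorbit G U w j (U h x) = coorbit G U w j x"
proof -
  have "U g w \<bullet> U h x = U (inv\<^bsub>G\<^esub> h \<otimes>\<^bsub>G\<^esub> g) w \<bullet> x" if "g \<in> carrier G" for g
    using that h by (simp add: rep_mult rep_inner_left)
  then have "image_mset (\<lambda>g. U g w \<bullet> U h x) (mset_set (carrier G)) =
      image_mset (\<lambda>g. U (inv\<^bsub>G\<^esub> h \<otimes>\<^bsub>G\<^esub> g) w \<bullet> x) (mset_set (carrier G))"
    by (intro image_mset_cong) (cases "finite (carrier G)"; simp)
  also have "\<dots> = image_mset (\<lambda>g. U g w \<bullet> x)
      (image_mset (\<lambda>g. inv\<^bsub>G\<^esub> h \<otimes>\<^bsub>G\<^esub> g) (mset_set (carrier G)))"
    by (simp add: multiset.map_comp o_def)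
  also have "image_mset (\<lambda>g. inv\<^bsub>G\<^esub> h \<otimes>\<^bsub>G\<^esub> g) (mset_set (carrier G)) = mset_set (carrier G)"
    using bij_betw_left[of "inv\<^bsub>G\<^esub> h"] h
    by (simp add: image_mset_mset_set bij_betw_def)
  finally show ?thesis by (simp add: coorbit_def)
qed

lemma orbit_lift_coorbit_map:
  "orbit_lift (coorbit_map G U w e) (orbit G U x) = coorbit_map G U w e x"
  by (rule orbit_lift_orbit[OF grp]) (simp add: coorbit_map_def coorbit_invariant split: prod.split)

lemma orbit_dist_orbit:
  "orbit_dist G U (orbit G U x) (orbit G U y) = Min {norm (x - U g y) | g. g \<in> carrier G}"
proof -
  have eq: "{norm (U a x - U g (U b y)) | g. g \<in> carrier G} = {norm (x - U g y) | g. g \<in> carrier G}"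
    if a: "a \<in> carrier G" and b: "b \<in> carrier G" for a b
  proof -
    have *: "norm (U a x - U (a \<otimes>\<^bsub>G\<^esub> g) y) = norm (x - U g y)" if "g \<in> carrier G" for g
      using that a rep_norm[of a "x - U g y"] by (simp add: rep_mult linear_diff rep_linear)
    have 1: "norm (U a x - U g (U b y)) = norm (x - U (inv\<^bsub>G\<^esub> a \<otimes>\<^bsub>G\<^esub> (g \<otimes>\<^bsub>G\<^esub> b)) y)"
      if "g \<in> carrier G" for g
      using *[of "inv\<^bsub>G\<^esub> a \<otimes>\<^bsub>G\<^esub> (g \<otimes>\<^bsub>G\<^esub> b)"] that a b by (simp add: rep_mult m_assoc[symmetric])
    have 2: "norm (x - U g y) = norm (U a x - U (a \<otimes>\<^bsub>G\<^esub> g \<otimes>\<^bsub>G\<^esub> inv\<^bsub>G\<^esub> b) (U b y))"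
      if "g \<in> carrier G" for g
      using *[of g] that a b by (simp add: rep_mult[symmetric] m_assoc)
    show ?thesis
    proof (intro equalityI subsetI)
      fix r assume "r \<in> {norm (U a x - U g (U b y)) | g. g \<in> carrier G}"
      then obtain g where "g \<in> carrier G" "r = norm (U a x - U g (U b y))" by blast
      then show "r \<in> {norm (x - U g y) | g. g \<in> carrier G}"
        using 1[of g] a b by (intro CollectI exI[of _ "inv\<^bsub>G\<^esub> a \<otimes>\<^bsub>G\<^esub> (g \<otimes>\<^bsub>G\<^esub> b)"]) auto
    next
      fix r assume "r \<in> {norm (x - U g y) | g. g \<in> carrier G}"
      then obtain g where "g \<in> carrier G" "r = norm (x - U g y)" by blast
      then show "r \<in> {norm (U a x - U g (U b y)) | g. g \<in> carrier G}"
        using 2[of g] a b by (intro CollectI exI[of _ "a \<otimes>\<^bsub>G\<^esub> g \<otimes>\<^bsub>G\<^esub> inv\<^bsub>G\<^esub> b"]) auto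
    qed
  qed
  let ?m = "Min {norm (x - U g y) | g. g \<in> carrier G}"
  have "(\<lambda>(x, y). Min {norm (x - U g y) | g. g \<in> carrier G}) ` (orbit G U x \<times> orbit G U y) = {?m}"
  proof (intro equalityI subsetI)
    fix r assume "r \<in> (\<lambda>(x, y). Min {norm (x - U g y) | g. g \<in> carrier G}) `
      (orbit G U x \<times> orbit G U y)"
    then show "r \<in> {?m}" by (auto simp: orbit_def eq)
  next
    fix r assume "r \<in> {?m}"
    moreover have "x \<in> orbit G U x" "y \<in> orbit G U y"
      using rep_one one_closed unfolding orbit_def by (metis (mono_tags, lifting) mem_Collect_eq)+
    ultimately show "r \<in> (\<lambda>(x, y). Min {norm (x - U g y) | g. g \<in> carrier G}) `
      (orbit G U x \<times> orbit G U y)" by (intro image_eqI[of _ _ "(x, y)"]) auto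
  qed
  then show ?thesis by (simp add: orbit_dist_def)
qed

end

end

theory Submission
  imports Defs
begin

text \<open>
  Sorting picks each coordinate of the coorbit map \<open>\<Phi>\<close> from finitely many linear functionals
  \<open>x \<mapsto> U g w \<bullet> x\<close>, and it does so continuously. Hence \<open>\<Phi>\<close> is continuous and at every point agrees
  with one of finitely many linear maps, its pieces. Both halves of the conclusion follow from this.

  Injectivity. A difference \<open>\<Phi> x - \<Phi> y\<close> lies in one of the finitely many subspaces
  \<open>E A B = {A x - B y | x y}\<close> with pieces \<open>A\<close>, \<open>B\<close>. On the fixed space of the representation all
  pieces coincide, so \<open>(x, y) \<mapsto> A x - B y\<close> kills the diagonal copy of the fixed space in
  \<open>\<V> \<times> \<V>\<close>, and \<open>E A B\<close> has dimension at most \<open>2 d - d\<^sub>G\<close>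
  (lemma \<open>subspace_dim_piece_differences\<close>). Failing to be injective on such a subspace forces a nonzero
  polynomial in the entries of a matrix with \<open>2 d - d\<^sub>G\<close> rows to vanish
  (lemma \<open>injective_on_subspace_polynomial\<close>), and finitely many nonzero polynomials are nonzero
  simultaneously on a dense Zariski open set (lemma \<open>zariski_generic_nonzero\<close>). A matrix \<open>L\<close> in that
  set annihilates no nonzero difference \<open>\<Phi> x - \<Phi> y\<close>, so it preserves the injectivity of \<open>\<Phi>\<close> on
  orbits.

  Bi-Lipschitz bounds. Moving \<open>x\<close> changes each sorted entry by at most the largest change of an
  unsorted entry, which gives the upper bound. The lower bound holds for every \<open>L\<close> for which
  \<open>L \<circ> \<Phi>\<close> separates orbits (lemma \<open>bi_lipschitz_of_separating\<close>): the map
  \<open>F (x, y) = L (\<Phi> x) - L (\<Phi> y)\<close> on \<open>\<V> \<times> \<V>\<close> is again continuous and piecewise linear, its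
  zeros are the pairs in a common orbit, and the norm of such a map bounds the distance to its zero
  set from above up to a constant (lemma \<open>piecewise_linear_error_bound\<close>). Finally, the distance
  between the orbits of \<open>x\<close> and \<open>y\<close> is at most twice the distance of \<open>(x, y)\<close> to that zero set.

  The error bound is proved by induction on the dimension of the space transverse to the periods of
  \<open>F\<close>. If it failed, points at which \<open>F\<close> is too small, normalised modulo the periods, would accumulate
  at a zero \<open>x\<close> of norm 1. Near \<open>x\<close> the map \<open>F\<close> is a translate of another map of the same kind, which
  has \<open>x\<close> as an additional period and so satisfies the error bound already.
\<close>

section \<open>Continuous piecewise linear maps\<close>

text \<open>
  Prescribing the finitely many linear pieces but not the polyhedral regions on which they are
  selected makes closure properties immediate; continuity supplies what is needed about the regions.
\<close>
definition piecewise_linear :: "('a::euclidean_space \<Rightarrow> 'b::euclidean_space) \<Rightarrow> bool" where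
  "piecewise_linear F \<longleftrightarrow> continuous_on UNIV F \<and>
     (\<exists>\<A>. finite \<A> \<and> (\<forall>A\<in>\<A>. linear A) \<and> (\<forall>x. \<exists>A\<in>\<A>. F x = A x))"

lemma finite_range_constant_on_convex:
  fixes h :: "real \<Rightarrow> 'b::real_normed_vector"
  assumes "convex T" "continuous_on T h" "finite C" "h ` T \<subseteq> C" "s \<in> T" "t \<in> T"
  shows "h s = h t"
proof -
  have "connected (h ` T)"
    using assms(1,2) by (intro connected_continuous_image convex_connected)
  moreover have "finite (h ` T)"
    using assms(3,4) finite_subset by blast
  ultimately obtain a where "h ` T = {a}"
    using connected_finite_iff_sing assms(5) by (metis empty_iff imageI)
  then show ?thesis
    using assms(5,6) by (metis imageI singletonD)
qed

text \<open>
  Along a ray, \<open>F (s x) / s\<close> is continuous in \<open>s\<close> and takes values among the finitely many \<open>A x\<close>, so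
  it is constant.
\<close>
lemma piecewise_linear_scale:
  assumes F: "piecewise_linear F" and "t > 0"
  shows "F (t *\<^sub>R x) = t *\<^sub>R F x"
proof -
  obtain \<A> where A: "finite \<A>" "\<And>A. A \<in> \<A> \<Longrightarrow> linear A" "\<And>x. \<exists>A\<in>\<A>. F x = A x"
    and cont: "continuous_on UNIV F"
    using F unfolding piecewise_linear_def by metis
  define h where "h s = (1 / s) *\<^sub>R F (s *\<^sub>R x)" for s :: real
  have "h t = h 1"
  proof (rule finite_range_constant_on_convex[where T = "{0<..}" and C = "(\<lambda>A. A x) ` \<A>"])
    show "continuous_on {0<..} h"
      unfolding h_def
      by (intro continuous_intros continuous_on_compose2[OF cont]) auto
    show "h ` {0<..} \<subseteq> (\<lambda>A. A x) ` \<A>"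
    proof
      fix v assume "v \<in> h ` {0<..}"
      then obtain s where s: "s > 0" "v = h s" by auto
      obtain B where B: "B \<in> \<A>" "F (s *\<^sub>R x) = B (s *\<^sub>R x)" using A(3) by blast
      then show "v \<in> (\<lambda>A. A x) ` \<A>"
        using s A(2)[of B] by (auto simp: h_def linear_scale)
    qed
  qed (use assms A in auto)
  then show ?thesis
    using \<open>t > 0\<close> by (simp add: h_def divide_simps) (metis scaleR_one scaleR_scaleR nonzero_mult_div_cancel_left less_irrefl divide_inverse mult.commute mult_1)
qed

lemma piecewise_linear_zero:
  assumes "piecewise_linear F"
  shows "F 0 = 0"
  using assms unfolding piecewise_linear_def by (metis linear_0)

text \<open>
  Close to a zero \<open>x\<close> of \<open>F\<close> only pieces \<open>A\<close> with \<open>A x = 0\<close> are selected, because the others stay away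
  from \<open>F\<close> there. Such pieces satisfy \<open>A (x + u) = A u\<close>, which makes \<open>F (x + u)\<close> positively homogeneous
  in small \<open>u\<close>; the local model \<open>F'\<close> is its homogeneous extension. As there are finitely many
  pieces, the radius \<open>\<epsilon>\<close> does not depend on the direction of \<open>u\<close>.
\<close>
lemma piecewise_linear_localize:
  fixes F :: "'a::euclidean_space \<Rightarrow> 'b::euclidean_space"
  assumes F: "piecewise_linear F" and x: "F x = 0"
  obtains F' \<epsilon> where "\<epsilon> > 0" "piecewise_linear F'" "\<And>u. norm u < \<epsilon> \<Longrightarrow> F (x + u) = F' u"
proof -
  obtain \<A> where A: "finite \<A>" "\<And>A. A \<in> \<A> \<Longrightarrow> linear A" "\<And>x. \<exists>A\<in>\<A>. F x = A x"
    and cont: "continuous_on UNIV F"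
    using F unfolding piecewise_linear_def by metis
  have "\<forall>A\<in>{A\<in>\<A>. A x \<noteq> 0}. \<forall>\<^sub>F y in nhds x. F y \<noteq> A y"
  proof
    fix B assume B: "B \<in> {A\<in>\<A>. A x \<noteq> 0}"
    have "open {y. F y \<noteq> B y}"
      using B A(2) by (intro open_Collect_neq cont linear_continuous_on_compose[OF continuous_on_id]) auto
    then show "\<forall>\<^sub>F y in nhds x. F y \<noteq> B y"
      using B x unfolding eventually_nhds by (intro exI[of _ "{y. F y \<noteq> B y}"]) auto
  qed
  then have "\<forall>\<^sub>F y in nhds x. \<forall>A\<in>{A\<in>\<A>. A x \<noteq> 0}. F y \<noteq> A y"
    using A(1) by (intro eventually_ball_finite) auto
  then obtain \<epsilon> where eps: "\<epsilon> > 0"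
    "\<And>y A. dist y x < \<epsilon> \<Longrightarrow> A \<in> \<A> \<Longrightarrow> A x \<noteq> 0 \<Longrightarrow> F y \<noteq> A y"
    unfolding eventually_nhds_metric by blast
  have active: "\<exists>A\<in>\<A>. A x = 0 \<and> F (x + u) = A u" if u: "norm u < \<epsilon>" for u
  proof -
    obtain B where B: "B \<in> \<A>" "F (x + u) = B (x + u)" using A(3) by blast
    then have "B x = 0" using eps(2)[of "x + u" B] u by (auto simp: dist_norm)
    then show ?thesis using B A(2)[of B] by (auto simp: linear_add)
  qed
  \<comment> \<open>The scale \<open>s u\<close> brings \<open>u\<close> into the ball of radius \<open>\<epsilon>\<close> and depends continuously on \<open>u\<close>, so that
    continuity of \<open>F'\<close> is inherited from \<open>F\<close>.\<close>
  define s where "s u = \<epsilon> / (norm u + 1)" for u :: 'a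
  have s: "s u > 0" "s u * norm u < \<epsilon>" for u
  proof -
    have "norm u + 1 > 0" by (simp add: add_nonneg_pos)
    then show "s u > 0" "s u * norm u < \<epsilon>"
      using eps(1) by (auto simp: s_def pos_divide_less_eq algebra_simps)
  qed
  define F' where "F' u = (1 / s u) *\<^sub>R F (x + s u *\<^sub>R u)" for u
  have agree: "F (x + u) = F' u" if u: "norm u < \<epsilon>" for u
  proof -
    define h where "h t = (1 / t) *\<^sub>R F (x + t *\<^sub>R u)" for t :: real
    define a b where "a = min 1 (s u)" and "b = max 1 (s u)"
    have range: "t > 0" "norm (t *\<^sub>R u) < \<epsilon>" if "t \<in> {a..b}" for t
    proof -
      show t0: "t > 0" using that s(1)[of u] by (auto simp: a_def)
      have "t * norm u \<le> b * norm u" using that by (intro mult_right_mono) auto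
      also have "b * norm u < \<epsilon>" using u s(2)[of u] by (auto simp: b_def max_def)
      finally show "norm (t *\<^sub>R u) < \<epsilon>" using t0 by simp
    qed
    have "h 1 = h (s u)"
    proof (rule finite_range_constant_on_convex[where T = "{a..b}" and C = "(\<lambda>A. A u) ` \<A>"])
      have "t \<noteq> 0" if "t \<in> {a..b}" for t using range(1)[OF that] by simp
      then show "continuous_on {a..b} h"
        unfolding h_def
        by (intro continuous_intros continuous_on_compose2[OF cont]) auto
      show "h ` {a..b} \<subseteq> (\<lambda>A. A u) ` \<A>"
      proof
        fix v assume "v \<in> h ` {a..b}"
        then obtain t where t: "t \<in> {a..b}" "v = h t" by auto
        obtain B where B: "B \<in> \<A>" "F (x + t *\<^sub>R u) = B (t *\<^sub>R u)"
          using active range[OF t(1)] by blast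
        then show "v \<in> (\<lambda>A. A u) ` \<A>"
          using t(2) range(1)[OF t(1)] A(2)[of B] by (auto simp: h_def linear_scale)
      qed
    qed (use A in \<open>auto simp: a_def b_def\<close>)
    then show ?thesis by (simp add: h_def F'_def)
  qed
  have "continuous_on UNIV s"
    unfolding s_def by (intro continuous_intros) (metis add_nonneg_pos less_irrefl norm_ge_zero zero_less_one)
  moreover have "s u \<noteq> 0" for u using s(1)[of u] by simp
  ultimately have "continuous_on UNIV F'"
    unfolding F'_def by (intro continuous_intros continuous_on_compose2[OF cont]) auto
  moreover have "\<exists>A\<in>\<A>. F' u = A u" for u
  proof -
    obtain B where "B \<in> \<A>" "F (x + s u *\<^sub>R u) = B (s u *\<^sub>R u)"
      using active[of "s u *\<^sub>R u"] s[of u] by auto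
    then show ?thesis using s(1)[of u] A(2)[of B] by (auto simp: F'_def linear_scale)
  qed
  ultimately have "piecewise_linear F'"
    unfolding piecewise_linear_def using A by blast
  then show thesis using that eps(1) agree by blast
qed

definition periods :: "('a::ab_group_add \<Rightarrow> 'b) \<Rightarrow> 'a set" where
  "periods F = {v. \<forall>y. F (y + v) = F y}"

text \<open>
  Positive homogeneity turns the set of periods, in general only an additive group, into a linear
  subspace.
\<close>
lemma subspace_periods:
  assumes "piecewise_linear F"
  shows "subspace (periods F)"
proof -
  have pos: "c *\<^sub>R v \<in> periods F" if v: "v \<in> periods F" and "c > 0" for c v
  proof -
    have "F (y + c *\<^sub>R v) = F y" for y
    proof -
      have "F (y + c *\<^sub>R v) = F (c *\<^sub>R ((1 / c) *\<^sub>R y + v))"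
        using \<open>c > 0\<close> by (simp add: scaleR_add_right)
      also have "\<dots> = c *\<^sub>R F ((1 / c) *\<^sub>R y)"
        using v piecewise_linear_scale[OF assms \<open>c > 0\<close>] by (simp add: periods_def)
      also have "\<dots> = F y"
        using piecewise_linear_scale[OF assms \<open>c > 0\<close>, of "(1 / c) *\<^sub>R y"] \<open>c > 0\<close> by simp
      finally show ?thesis .
    qed
    then show ?thesis by (simp add: periods_def)
  qed
  have neg: "- v \<in> periods F" if "v \<in> periods F" for v
  proof -
    have "F (y + - v) = F y" for y
    proof -
      have "F ((y + - v) + v) = F (y + - v)" using that unfolding periods_def by blast
      then show ?thesis by simp
    qed
    then show ?thesis by (simp add: periods_def)
  qed
  have "c *\<^sub>R v \<in> periods F" if v: "v \<in> periods F" for c v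
  proof (cases c "0 :: real" rule: linorder_cases)
    case less
    then show ?thesis using pos[OF neg[OF v], of "- c"] by simp
  next
    case equal
    then show ?thesis by (simp add: periods_def)
  next
    case greater
    then show ?thesis using pos v by blast
  qed
  moreover have "u + v \<in> periods F" if "u \<in> periods F" "v \<in> periods F" for u v
    using that by (simp add: periods_def add.assoc[symmetric])
  ultimately show ?thesis
    by (auto intro!: subspaceI simp: periods_def)
qed

lemma exists_small_scale:
  fixes U :: "'a::real_normed_vector set"
  assumes "\<epsilon> > 0" "finite U"
  obtains t :: real where "t > 0" "\<And>u. u \<in> U \<Longrightarrow> norm (t *\<^sub>R u) < \<epsilon>"
proof -
  define M where "M = (\<Sum>u\<in>U. norm u) + 1"
  have M: "M > 0" by (simp add: M_def add_nonneg_pos sum_nonneg)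
  have "norm ((\<epsilon> / M) *\<^sub>R u) < \<epsilon>" if "u \<in> U" for u
  proof -
    have "norm u \<le> (\<Sum>u\<in>U. norm u)" using that assms(2) by (intro member_le_sum) auto
    then have "norm u < M" by (simp add: M_def)
    then show ?thesis using M assms(1) by (simp add: pos_divide_less_eq)
  qed
  then show thesis using that[of "\<epsilon> / M"] M assms(1) by simp
qed

text \<open>
  Localising at \<open>x\<close> keeps the old periods. It adds \<open>x\<close> itself because \<open>F\<close> is homogeneous:
  \<open>x + t (y + x)\<close> is a positive multiple of \<open>x + r y\<close> with \<open>r = t / (1 + t)\<close>. This gain of a period is
  what makes the induction in the error bound progress.
\<close>
lemma periods_localize:
  fixes F :: "'a::euclidean_space \<Rightarrow> 'b::euclidean_space"
  assumes F: "piecewise_linear F" and F': "piecewise_linear F'" and "\<epsilon> > 0"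
    and agree: "\<And>u. norm u < \<epsilon> \<Longrightarrow> F (x + u) = F' u"
  shows "periods F \<subseteq> periods F'" "x \<in> periods F'"
proof -
  note hom = piecewise_linear_scale[OF F'] and homF = piecewise_linear_scale[OF F]
  show "periods F \<subseteq> periods F'"
  proof
    fix v assume v: "v \<in> periods F"
    have "F' (y + v) = F' y" for y
    proof -
      obtain t :: real where t: "t > 0" "norm (t *\<^sub>R y) < \<epsilon>" "norm (t *\<^sub>R (y + v)) < \<epsilon>"
        using exists_small_scale[OF \<open>\<epsilon> > 0\<close>, of "{y, y + v}"]
        by (metis finite.emptyI finite.insertI insertCI)
      have "t *\<^sub>R v \<in> periods F" using subspace_periods[OF F] v by (rule subspace_scale)
      then have "F ((x + t *\<^sub>R y) + t *\<^sub>R v) = F (x + t *\<^sub>R y)" unfolding periods_def by blast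
      then have "F' (t *\<^sub>R (y + v)) = F' (t *\<^sub>R y)"
        using agree[OF t(2)] agree[OF t(3)] by (simp add: algebra_simps)
      then show ?thesis using t(1) by (simp add: hom)
    qed
    then show "v \<in> periods F'" by (simp add: periods_def)
  qed
  have "F' (y + x) = F' y" for y
  proof -
    obtain t :: real where t: "t > 0" "norm (t *\<^sub>R y) < \<epsilon>" "norm (t *\<^sub>R (y + x)) < \<epsilon>"
      using exists_small_scale[OF \<open>\<epsilon> > 0\<close>, of "{y, y + x}"]
      by (metis finite.emptyI finite.insertI insertCI)
    define r where "r = t / (1 + t)"
    have r: "r > 0" "r \<le> t" "(1 + t) * r = t"
      using t(1) by (auto simp: r_def divide_simps algebra_simps)
    have "norm (r *\<^sub>R y) \<le> norm (t *\<^sub>R y)" using r(1,2) t(1) by (simp add: mult_right_mono)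
    then have small: "norm (r *\<^sub>R y) < \<epsilon>" using t(2) by simp
    have "F' (t *\<^sub>R (y + x)) = F (x + t *\<^sub>R (y + x))" using agree[OF t(3)] by simp
    also have "x + t *\<^sub>R (y + x) = (1 + t) *\<^sub>R (x + r *\<^sub>R y)"
      using r(3) by (simp add: scaleR_add_right scaleR_add_left)
    also have "F \<dots> = (1 + t) *\<^sub>R F' (r *\<^sub>R y)" using t(1) agree[OF small] by (simp add: homF)
    also have "\<dots> = t *\<^sub>R F' y" using r by (simp add: hom)
    finally show ?thesis using t(1) by (simp add: hom)
  qed
  then show "x \<in> periods F'" by (simp add: periods_def)
qed

text \<open>
  The statement is the analogue for piecewise linear maps of the fact that an injective linear map is
  bounded below. Translating by periods changes neither \<open>F\<close> nor the zero set, so compactness is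
  needed only on the unit sphere of the orthogonal complement of the periods, and a counterexample
  sequence can be taken there.
\<close>
lemma piecewise_linear_error_bound:
  fixes F :: "'a::euclidean_space \<Rightarrow> 'b::euclidean_space"
  assumes "piecewise_linear F"
  shows "\<exists>a>0. \<forall>p. \<exists>z. F z = 0 \<and> a * dist p z \<le> norm (F p)"
  using assms
proof (induction "DIM('a) - dim (periods F)" arbitrary: F rule: less_induct)
  case less
  note F = less.prems
  define K where "K = periods F"
  have K: "subspace K" unfolding K_def by (rule subspace_periods[OF F])
  show ?case
  proof (rule ccontr)
    assume neg: "\<not> (\<exists>a>0. \<forall>p. \<exists>z. F z = 0 \<and> a * dist p z \<le> norm (F p))"
    \<comment> \<open>Each violation of the bound is projected off \<open>K\<close> and rescaled to norm 1; both operations keep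
      it a violation.\<close>
    have "\<exists>r. norm r = 1 \<and> (\<forall>k\<in>K. r \<bullet> k = 0) \<and>
        (\<forall>z. F z = 0 \<longrightarrow> norm (F r) < 1 / (real n + 1) * dist r z)" for n :: nat
    proof -
      define a where "a = 1 / (real n + 1)"
      have "a > 0" by (simp add: a_def add_nonneg_pos)
      then obtain p where p: "\<And>z. F z = 0 \<Longrightarrow> norm (F p) < a * dist p z"
        using neg by (metis not_le)
      obtain k q where k: "k \<in> K" and q: "\<And>v. v \<in> K \<Longrightarrow> orthogonal q v" and pk: "p = k + q"
        using orthogonal_subspace_decomp_exists[of K p] K by (metis span_eq_iff)
      have shift: "F (y + k) = F y" for y using k by (simp add: K_def periods_def)
      have qz: "norm (F q) < a * dist q z" if "F z = 0" for z
      proof -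
        have "F (z + k) = 0" "F p = F q" using that shift[of z] shift[of q] pk by (auto simp: add.commute)
        then show ?thesis using p[of "z + k"] pk by (simp add: dist_norm algebra_simps)
      qed
      have "q \<noteq> 0" using qz[of 0] piecewise_linear_zero[OF F] by auto
      define c where "c = norm q"
      have c: "c > 0" using \<open>q \<noteq> 0\<close> by (simp add: c_def)
      define r where "r = (1 / c) *\<^sub>R q"
      have qr: "q = c *\<^sub>R r" using c by (simp add: r_def)
      have "norm (F r) < a * dist r z" if "F z = 0" for z
      proof -
        have "F (c *\<^sub>R z) = 0" using that piecewise_linear_scale[OF F c] by simp
        then have "norm (F q) < a * dist (c *\<^sub>R r) (c *\<^sub>R z)" using qz qr by metis
        moreover have "norm (F q) = c * norm (F r)"
          using c qr piecewise_linear_scale[OF F c] by simp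
        moreover have "dist (c *\<^sub>R r) (c *\<^sub>R z) = c * dist r z"
          using c by (simp add: dist_norm scaleR_diff_right[symmetric])
        ultimately have "c * norm (F r) < c * (a * dist r z)" by (simp add: algebra_simps)
        then show ?thesis using c by simp
      qed
      moreover have "norm r = 1" using c by (simp add: r_def c_def)
      moreover have "r \<bullet> v = 0" if "v \<in> K" for v
        using q[OF that] by (simp add: r_def orthogonal_def)
      ultimately show ?thesis unfolding a_def by blast
    qed
    then obtain r where r: "\<And>n. norm (r n) = 1" "\<And>n k. k \<in> K \<Longrightarrow> r n \<bullet> k = 0"
      "\<And>n z. F z = 0 \<Longrightarrow> norm (F (r n)) < 1 / (real n + 1) * dist (r n) z"
      by metis
    obtain x \<sigma> where x: "x \<in> sphere 0 1" and sig: "strict_mono (\<sigma> :: nat \<Rightarrow> nat)"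
      and lim: "(r \<circ> \<sigma>) \<longlonglongrightarrow> x"
      using r(1) compact_sphere[of "0::'a" 1, unfolded compact_def] by (metis dist_0_norm mem_sphere)
    have small: "norm (F (r (\<sigma> n))) \<le> 1 / (real n + 1) * dist (r (\<sigma> n)) z" if "F z = 0" for n z
    proof -
      have "1 / (real (\<sigma> n) + 1) \<le> 1 / (real n + 1)"
        using seq_suble[OF sig, of n] by (intro divide_left_mono) auto
      then have "1 / (real (\<sigma> n) + 1) * dist (r (\<sigma> n)) z \<le> 1 / (real n + 1) * dist (r (\<sigma> n)) z"
        by (rule mult_right_mono) simp
      then show ?thesis using r(3)[OF that, of "\<sigma> n"] by linarith
    qed
    have "continuous_on UNIV F" using F by (simp add: piecewise_linear_def)
    then have "(\<lambda>n. F ((r \<circ> \<sigma>) n)) \<longlonglongrightarrow> F x"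
      using lim by (rule continuous_on_tendsto_compose) auto
    moreover have "(\<lambda>n. F ((r \<circ> \<sigma>) n)) \<longlonglongrightarrow> 0"
    proof (rule Lim_null_comparison)
      show "\<forall>\<^sub>F n in sequentially. norm (F ((r \<circ> \<sigma>) n)) \<le> 1 / (real n + 1)"
        using small[OF piecewise_linear_zero[OF F]] r(1) by (auto intro: always_eventually)
      show "(\<lambda>n. 1 / (real n + 1)) \<longlonglongrightarrow> 0"
        using LIMSEQ_inverse_real_of_nat by (simp add: inverse_eq_divide add.commute)
    qed
    ultimately have Fx: "F x = 0" by (rule LIMSEQ_unique)
    have "x \<bullet> k = 0" if "k \<in> K" for k
    proof -
      have "(\<lambda>n. (r \<circ> \<sigma>) n \<bullet> k) \<longlonglongrightarrow> x \<bullet> k" by (intro tendsto_intros lim)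
      moreover have "(\<lambda>n. (r \<circ> \<sigma>) n \<bullet> k) = (\<lambda>n. 0)" using r(2)[OF that] by auto
      ultimately show ?thesis by (simp add: LIMSEQ_const_iff)
    qed
    moreover have "x \<noteq> 0" using x by auto
    ultimately have "x \<notin> K" by (metis inner_eq_zero_iff)
    obtain F' \<epsilon> where eps: "\<epsilon> > 0" and F': "piecewise_linear F'"
      and agree: "\<And>u. norm u < \<epsilon> \<Longrightarrow> F (x + u) = F' u"
      using piecewise_linear_localize[OF F Fx] by metis
    have "K \<subset> periods F'"
      using periods_localize[OF F F' eps agree] \<open>x \<notin> K\<close> by (auto simp: K_def)
    then have "dim K < dim (periods F')"
      using K subspace_periods[OF F'] by (intro dim_psubset) (simp add: span_eq_iff[THEN iffD2])
    then have "DIM('a) - dim (periods F') < DIM('a) - dim (periods F)"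
      using dim_subset_UNIV[of "periods F'"] unfolding K_def by linarith
    from less.hyps[OF this F'] obtain a where a: "a > 0"
      and bound: "\<And>u. \<exists>z. F' z = 0 \<and> a * dist u z \<le> norm (F' u)" by blast
    have "\<forall>\<^sub>F n in sequentially. dist ((r \<circ> \<sigma>) n) x < \<epsilon> / 2"
      using tendstoD[OF lim, of "\<epsilon> / 2"] eps by simp
    moreover have "\<forall>\<^sub>F n in sequentially. 1 / (real n + 1) < a"
    proof -
      have "(\<lambda>n. 1 / (real n + 1)) \<longlonglongrightarrow> 0"
        using LIMSEQ_inverse_real_of_nat by (simp add: inverse_eq_divide add.commute)
      then show ?thesis using a by (rule order_tendstoD)
    qed
    ultimately have "\<forall>\<^sub>F n in sequentially. dist ((r \<circ> \<sigma>) n) x < \<epsilon> / 2 \<and> 1 / (real n + 1) < a"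
      by (rule eventually_conj)
    then obtain n where n: "dist (r (\<sigma> n)) x < \<epsilon> / 2" "1 / (real n + 1) < a"
      by (auto simp: eventually_sequentially)
    define u where "u = r (\<sigma> n) - x"
    have u: "norm u < \<epsilon> / 2" "r (\<sigma> n) = x + u" using n(1) by (auto simp: u_def dist_norm)
    obtain z where z: "F' z = 0" "a * dist u z \<le> norm (F (r (\<sigma> n)))"
      using bound[of u] agree[of u] u eps by auto
    \<comment> \<open>The zero \<open>x + z\<close> may lie outside the ball where \<open>F\<close> and \<open>F'\<close> agree; then \<open>x\<close> itself is
      the nearer zero.\<close>
    define z' where "z' = (if dist u z \<le> norm u then x + z else x)"
    have "F z' = 0"
    proof (cases "dist u z \<le> norm u")
      case True
      have "norm z \<le> norm u + dist u z"
        using norm_triangle_ineq4[of u "u - z"] by (simp add: dist_norm)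
      then have "norm z < \<epsilon>" using True u(1) by linarith
      then show ?thesis using agree[of z] z(1) True by (simp add: z'_def)
    next
      case False
      then show ?thesis using Fx by (simp add: z'_def)
    qed
    have "dist (r (\<sigma> n)) z' \<le> dist u z"
      by (auto simp: z'_def u(2) dist_norm)
    then have "a * dist (r (\<sigma> n)) z' \<le> norm (F (r (\<sigma> n)))"
      using z(2) a by (meson mult_left_mono less_imp_le order_trans)
    also have "\<dots> < 1 / (real (\<sigma> n) + 1) * dist (r (\<sigma> n)) z'"
      using r(3)[OF \<open>F z' = 0\<close>] .
    finally have "a * dist (r (\<sigma> n)) z' < 1 / (real (\<sigma> n) + 1) * dist (r (\<sigma> n)) z'" .
    then have "a < 1 / (real (\<sigma> n) + 1)"
      by (rule mult_right_less_imp_less) simp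
    moreover have "1 / (real (\<sigma> n) + 1) \<le> 1 / (real n + 1)"
      using seq_suble[OF sig, of n] by (intro divide_left_mono) auto
    ultimately show False using n(2) by linarith
  qed
qed

section \<open>Sorted coordinates\<close>

text \<open>
  Comparing the \<open>k\<close>-th smallest entry with a threshold amounts to counting the entries below that
  threshold. Counting does not refer to the order of the entries, so it survives a perturbation
  that changes the order.
\<close>
lemma sorted_nth_le_iff:
  fixes ys :: "'a::linorder list"
  assumes "sorted ys" "k < length ys"
  shows "ys ! k \<le> t \<longleftrightarrow> k < length (filter (\<lambda>y. y \<le> t) ys)"
  using assms
proof (induction ys arbitrary: k)
  case (Cons y ys)
  show ?case
  proof (cases "y \<le> t")
    case True
    then show ?thesis using Cons by (cases k) auto
  next
    case False
    then have "filter (\<lambda>y. y \<le> t) (y # ys) = []"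
      using Cons.prems(1) by (auto simp: filter_empty_conv)
    moreover have "y \<le> (y # ys) ! k"
      using Cons.prems by (cases k) auto
    ultimately show ?thesis using False by simp
  qed
qed simp

lemma sorted_family_nth_le_iff:
  fixes f :: "'i \<Rightarrow> real"
  assumes "finite I" "k < card I"
  shows "sorted_list_of_multiset (image_mset f (mset_set I)) ! k \<le> t \<longleftrightarrow> k < card {i\<in>I. f i \<le> t}"
proof -
  let ?ys = "sorted_list_of_multiset (image_mset f (mset_set I))"
  have len: "length ?ys = card I"
    by (metis mset_sorted_list_of_multiset size_image_mset size_mset size_mset_set)
  have "length (filter (\<lambda>y. y \<le> t) ?ys) = size (filter_mset (\<lambda>y. y \<le> t) (mset ?ys))"
    by (metis mset_filter size_mset)
  also have "\<dots> = card {i\<in>I. f i \<le> t}"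
    using assms(1) by (simp add: filter_mset_image_mset)
  finally show ?thesis
    using sorted_nth_le_iff[of ?ys k t] assms(2) len
    by (metis sorted_sorted_list_of_multiset)
qed

text \<open>
  Sorting is 1-Lipschitz for the maximum norm: if \<open>h \<le> f + \<epsilon>\<close> then every index counted for \<open>f\<close> at
  threshold \<open>t\<close> is counted for \<open>h\<close> at threshold \<open>t + \<epsilon>\<close>.
\<close>
lemma sorted_family_nth_perturb:
  fixes f h :: "'i \<Rightarrow> real"
  assumes I: "finite I" "k < card I" and close: "\<And>i. i \<in> I \<Longrightarrow> \<bar>f i - h i\<bar> \<le> \<epsilon>"
  shows "\<bar>sorted_list_of_multiset (image_mset f (mset_set I)) ! k -
          sorted_list_of_multiset (image_mset h (mset_set I)) ! k\<bar> \<le> \<epsilon>"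
proof -
  let ?s = "\<lambda>f. sorted_list_of_multiset (image_mset f (mset_set I)) ! k"
  have "?s h \<le> ?s f + \<epsilon>" if "\<And>i. i \<in> I \<Longrightarrow> h i \<le> f i + \<epsilon>" for f h :: "'i \<Rightarrow> real"
  proof -
    have "k < card {i\<in>I. f i \<le> ?s f}" using sorted_family_nth_le_iff[OF I, of f "?s f"] by simp
    also have "\<dots> \<le> card {i\<in>I. h i \<le> ?s f + \<epsilon>}"
    proof (rule card_mono)
      show "{i\<in>I. f i \<le> ?s f} \<subseteq> {i\<in>I. h i \<le> ?s f + \<epsilon>}"
        using that by fastforce
    qed (use I in simp)
    finally show ?thesis using sorted_family_nth_le_iff[OF I] by blast
  qed
  from this[of h f] this[of f h] show ?thesis using close by (fastforce simp: abs_le_iff)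
qed

lemma coorbit_eq_sorted_nth:
  assumes "finite (carrier G)" "1 \<le> j" "j \<le> card (carrier G)"
  shows "coorbit G U w j x =
    sorted_list_of_multiset (image_mset (\<lambda>g. U g w \<bullet> x) (mset_set (carrier G))) ! (card (carrier G) - j)"
proof -
  have len: "length (sorted_list_of_multiset (image_mset f (mset_set (carrier G)))) = card (carrier G)"
    for f :: "'a \<Rightarrow> real"
    by (metis mset_sorted_list_of_multiset size_image_mset size_mset size_mset_set)
  show ?thesis
    using assms(2,3) by (simp add: coorbit_def rev_nth len)
qed

section \<open>Zariski-generic linear maps\<close>

lemma real_polynomial_nonzero_finite_roots:
  assumes "real_polynomial_function (p :: real \<Rightarrow> real)" "p t \<noteq> 0"
  shows "finite {t. p t = 0}"
proof -
  obtain a n where p: "p = (\<lambda>x. \<Sum>i\<le>n. a i * x ^ i)"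
    using real_polynomial_function_imp_sum[OF assms(1)] by blast
  then have "\<exists>i\<le>n. a i \<noteq> 0" using assms(2) by (metis (no_types, lifting) atMost_iff mult_eq_0_iff sum.neutral)
  then show ?thesis using polyfun_finite_roots[of a n] p by simp
qed

text \<open>
  Restricted to the line through \<open>x\<close> and \<open>y\<close>, both polynomials are nonzero polynomials in one variable
  and so have finitely many roots. Thus nonempty Zariski open sets meet.
\<close>
lemma real_polynomial_common_nonzero:
  assumes p: "real_polynomial_function p" "p x \<noteq> 0" and q: "real_polynomial_function q" "q y \<noteq> 0"
  shows "\<exists>z. p z \<noteq> 0 \<and> q z \<noteq> 0"
proof -
  define \<gamma> where "\<gamma> t = x + t *\<^sub>R (y - x)" for t :: real
  have gamma: "polynomial_function \<gamma>"
    unfolding \<gamma>_def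
    by (intro polynomial_function_add polynomial_function_mult polynomial_function_const polynomial_function_id)
  have "finite {t. (p \<circ> \<gamma>) t = 0}"
    using p(2) by (intro real_polynomial_nonzero_finite_roots[of _ 0]
        real_polynomial_function_compose[OF gamma p(1)]) (simp add: \<gamma>_def)
  moreover have "finite {t. (q \<circ> \<gamma>) t = 0}"
    using q(2) by (intro real_polynomial_nonzero_finite_roots[of _ 1]
        real_polynomial_function_compose[OF gamma q(1)]) (simp add: \<gamma>_def)
  ultimately have "finite ({t. (p \<circ> \<gamma>) t = 0} \<union> {t. (q \<circ> \<gamma>) t = 0})" by simp
  then obtain t where "t \<notin> {t. (p \<circ> \<gamma>) t = 0} \<union> {t. (q \<circ> \<gamma>) t = 0}"
    using infinite_UNIV_char_0[where 'a = real] by (metis UNIV_eq_I)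
  then show ?thesis by auto
qed

lemma zariski_generic_nonzero:
  fixes p :: "'i \<Rightarrow> 'c::euclidean_space \<Rightarrow> real"
  assumes "finite I" and poly: "\<And>i. i \<in> I \<Longrightarrow> real_polynomial_function (p i)"
    and nz: "\<And>i. i \<in> I \<Longrightarrow> \<exists>x. p i x \<noteq> 0"
  shows "zariski_generic (\<lambda>x. \<forall>i\<in>I. p i x \<noteq> 0)"
proof -
  define P where "P x = (\<Prod>i\<in>I. p i x)" for x
  have P: "real_polynomial_function P"
    unfolding P_def using assms(1) poly by (intro real_polynomial_function_prod)
  have P_nz: "P x \<noteq> 0 \<longleftrightarrow> (\<forall>i\<in>I. p i x \<noteq> 0)" for x
    using assms(1) by (simp add: P_def)
  have "\<exists>x. \<forall>i\<in>J. p i x \<noteq> 0" if "finite J" "J \<subseteq> I" for J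
    using that
  proof (induction J rule: finite_induct)
    case (insert j J)
    then obtain x y where x: "\<forall>i\<in>J. p i x \<noteq> 0" and y: "p j y \<noteq> 0" using nz[of j] by auto
    have "real_polynomial_function (\<lambda>x. \<Prod>i\<in>J. p i x)"
      using insert poly by (intro real_polynomial_function_prod) auto
    moreover have "(\<Prod>i\<in>J. p i x) \<noteq> 0" using x insert by simp
    ultimately show ?case
      using real_polynomial_common_nonzero[of "\<lambda>x. \<Prod>i\<in>J. p i x" x "p j" y] y poly insert by auto
  qed simp
  then obtain x0 where x0: "P x0 \<noteq> 0" using assms(1) P_nz by blast
  define O' where "O' = {x. P x \<noteq> 0}"
  have "openin zariski O'"
    unfolding openin_zariski
    by (rule zariski_openI[of "{P}"]) (use P in \<open>auto simp: O'_def\<close>)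
  moreover have "zariski closure_of O' = UNIV"
  proof -
    have "\<exists>z. z \<in> O' \<and> z \<in> T" if T: "x \<in> T" "openin zariski T" for x T
    proof -
      obtain Q where Q: "\<forall>q\<in>Q. real_polynomial_function q" "- T = {x. \<forall>q\<in>Q. q x = 0}"
        using T(2) unfolding openin_zariski zariski_open_def by (elim exE conjE)
      then obtain q where q: "q \<in> Q" "q x \<noteq> 0" using T(1) by blast
      obtain z where "P z \<noteq> 0" "q z \<noteq> 0"
        using real_polynomial_common_nonzero[OF P x0, of q x] q Q(1) by blast
      then show ?thesis using Q(2) q(1) by (auto simp: O'_def)
    qed
    then show ?thesis by (auto simp: closure_of_def)
  qed
  ultimately show ?thesis
    unfolding zariski_generic_def using P_nz by (intro exI[of _ O']) (auto simp: O'_def)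
qed

lemma real_polynomial_det:
  fixes M :: "real ^ 'n ^ 'm" and K :: "real ^ 'n ^ 'n"
  shows "real_polynomial_function (\<lambda>L :: real ^ 'm ^ 'n. det (L ** M + K))"
proof -
  have entry: "real_polynomial_function (\<lambda>L :: real ^ 'm ^ 'n. L $ i $ k)" for i k
    by (intro real_polynomial_function.intros(1)
          bounded_linear_compose[OF bounded_linear_vec_nth bounded_linear_vec_nth])
  have "real_polynomial_function (\<lambda>L :: real ^ 'm ^ 'n. (L ** M + K) $ i $ j)" for i j
    unfolding matrix_matrix_mult_def
    by (simp, intro real_polynomial_function.intros(3) real_polynomial_function_sum
          real_polynomial_function.intros(4) entry real_polynomial_function.intros(2)) auto
  then show ?thesis
    unfolding det_def
    by (intro real_polynomial_function_sum real_polynomial_function.intros(4)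
          real_polynomial_function_prod real_polynomial_function.intros(2)) (auto simp: finite_permutations)
qed

text \<open>
  If \<open>E\<close> had the full dimension \<open>CARD('n)\<close> and \<open>M\<close> were an isomorphism onto \<open>E\<close>, the polynomial
  \<open>det (L ** M)\<close> would do. In general let \<open>M\<close> map a subspace \<open>W\<close> of the right dimension onto \<open>E\<close> after
  a projection \<open>\<pi>\<close> onto \<open>W\<close>, and let \<open>K\<close> be the complementary projection. Then \<open>det (L ** M + K)\<close>
  detects the injectivity of \<open>L\<close> on \<open>E\<close>, since \<open>K\<close> vanishes on \<open>W\<close>; it equals 1 when \<open>L\<close> inverts \<open>M\<close>
  on \<open>W\<close>.
\<close>
lemma injective_on_subspace_polynomial:
  fixes E :: "(real ^ 'm) set"
  assumes E: "subspace E" and dim: "dim E \<le> CARD('n::finite)"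
  obtains p where "real_polynomial_function p" "\<exists>L. p L \<noteq> 0"
    "\<And>(L :: real ^ 'm ^ 'n) v. p L \<noteq> 0 \<Longrightarrow> v \<in> E \<Longrightarrow> L *v v = 0 \<Longrightarrow> v = 0"
proof -
  obtain W :: "(real ^ 'n) set" where W: "subspace W" "dim W = dim E"
    using choose_subspace_of_subspace[of "dim E" "UNIV :: (real ^ 'n) set"] dim by auto
  obtain f g where fg: "linear f" "linear g" "f ` W = E" "\<And>x. x \<in> W \<Longrightarrow> g (f x) = x"
    using isometries_subspaces[OF W(1) E W(2)] by metis
  obtain \<pi> :: "real ^ 'n \<Rightarrow> real ^ 'n" where
    pi: "range \<pi> \<subseteq> W" "linear \<pi>" "\<And>x. x \<in> W \<Longrightarrow> \<pi> x = x"
    using linear_exists_left_inverse_on[OF linear_id W(1)] by auto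
  define M where "M = matrix (f \<circ> \<pi>)"
  define K where "K = matrix (\<lambda>x. x - \<pi> x)"
  have M: "M *v x = f (\<pi> x)" for x
    unfolding M_def using fun_cong[OF matrix_vector_mul(2)[OF linear_compose[OF pi(2) fg(1)]]] by simp
  have K: "K *v x = x - \<pi> x" for x
    unfolding K_def
    by (rule fun_cong[OF matrix_vector_mul(2)]) (intro linear_compose_sub linear_ident pi(2))
  define p where "p L = det (L ** M + K)" for L :: "real ^ 'm ^ 'n"
  have act: "(L ** M + K) *v x = L *v f (\<pi> x) + (x - \<pi> x)" for L x
    by (simp add: matrix_vector_mult_add_rdistrib matrix_vector_mul_assoc[symmetric] M K)
  show thesis
  proof (rule that[of p])
    show "real_polynomial_function p" unfolding p_def by (rule real_polynomial_det)
    have "(matrix g ** M + K) *v x = x" for x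
      using act[of "matrix g" x] fg(4)[of "\<pi> x"] pi(1) fun_cong[OF matrix_vector_mul(2)[OF fg(2)]] by auto
    then have "matrix g ** M + K = mat 1" by (simp add: matrix_eq)
    then show "\<exists>L. p L \<noteq> 0" by (intro exI[of _ "matrix g"]) (simp add: p_def)
    fix L v assume nz: "p L \<noteq> 0" and v: "v \<in> E" "L *v v = 0"
    obtain x where x: "x \<in> W" "v = f x" using v(1) fg(3) by auto
    have "(L ** M + K) *v x = 0" using act[of L x] pi(3)[OF x(1)] x v(2) by simp
    moreover have "invertible (L ** M + K)" using nz by (simp add: p_def invertible_det_nz)
    ultimately have "x = 0"
      by (metis invertible_def matrix_vector_mul_assoc matrix_vector_mul_lid matrix_vector_mult_0_right)
    then show "v = 0" using x(2) linear_0[OF fg(1)] by simp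
  qed
qed

lemma dim_range_le_codim:
  fixes T :: "'a::euclidean_space \<Rightarrow> 'b::euclidean_space"
  assumes T: "linear T" and zero: "\<And>v. v \<in> D \<Longrightarrow> T v = 0"
  shows "dim (range T) + dim D \<le> DIM('a)"
proof -
  define C where "C = {y \<in> UNIV. \<forall>x \<in> span D. orthogonal x y}"
  have "range T \<subseteq> T ` C"
  proof
    fix b assume "b \<in> range T"
    then obtain x where x: "b = T x" by auto
    obtain y z where yz: "y \<in> span D" "\<And>w. w \<in> span D \<Longrightarrow> orthogonal z w" "x = y + z"
      using orthogonal_subspace_decomp_exists[of D x] by metis
    have "T y = 0" using yz(1) using linear_eq_0_on_span[OF T zero] by blast
    then have "b = T z" using x yz(3) T by (simp add: linear_add)
    then show "b \<in> T ` C" using yz(2) by (auto simp: C_def orthogonal_commute)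
  qed
  then have "dim (range T) \<le> dim C"
    using dim_image_le[OF T, of C] dim_subset[of "range T" "T ` C"] by linarith
  moreover have "dim C + dim (span D) = dim (UNIV :: 'a set)"
    unfolding C_def by (rule dim_subspace_orthogonal_to_vectors) auto
  ultimately show ?thesis by simp
qed

section \<open>The coorbit embedding\<close>

context
  fixes G :: "('g, 'b) monoid_scheme" and U :: "'g \<Rightarrow> 'a \<Rightarrow> 'a::euclidean_space"
    and w :: "nat \<Rightarrow> 'a" and e :: "'m::finite \<Rightarrow> nat \<times> nat"
  assumes grp: "group G" and U_hom: "U \<in> hom G linear_isometries" and fin: "finite (carrier G)"
    and range_e: "range e \<subseteq> {1..card (carrier G)} \<times> UNIV"
begin

lemma rank_range: "fst (e k) \<in> {1..card (carrier G)}"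
  using range_e by (auto simp: mem_Times_iff image_subset_iff)

text \<open>
  The linear map obtained when the entry selected in coordinate \<open>k\<close> is always the one belonging to the
  group element \<open>\<gamma> k\<close>; the sorting order determines which \<open>\<gamma>\<close> applies at a given point.
\<close>
definition coorbit_piece :: "('m \<Rightarrow> 'g) \<Rightarrow> 'a \<Rightarrow> real ^ 'm" where
  "coorbit_piece \<gamma> x = (\<chi> k. U (\<gamma> k) (w (snd (e k))) \<bullet> x)"

definition coorbit_pieces :: "('a \<Rightarrow> real ^ 'm) set" where
  "coorbit_pieces = coorbit_piece ` (UNIV \<rightarrow>\<^sub>E carrier G)"

lemma finite_coorbit_pieces: "finite coorbit_pieces"
  unfolding coorbit_pieces_def using fin by (intro finite_imageI finite_PiE) auto

lemma linear_coorbit_pieces: "A \<in> coorbit_pieces \<Longrightarrow> linear A"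
  unfolding coorbit_pieces_def coorbit_piece_def
  by (auto intro!: linearI simp: vec_eq_iff inner_add_right)

text \<open>
  For a fixed vector \<open>v\<close>, \<open>U g w \<bullet> v = U g w \<bullet> U g v = w \<bullet> v\<close> independently of \<open>g\<close>, so the selection
  does not matter. This accounts for the \<open>- d\<^sub>G\<close> in the target dimension.
\<close>
lemma coorbit_pieces_fixed:
  assumes "A \<in> coorbit_pieces" "B \<in> coorbit_pieces" "v \<in> fixed_space G U"
  shows "A v = B v"
proof -
  have "coorbit_piece \<gamma> v = (\<chi> k. w (snd (e k)) \<bullet> v)" if \<gamma>: "\<gamma> \<in> UNIV \<rightarrow>\<^sub>E carrier G" for \<gamma>
  proof -
    have "U (\<gamma> k) y \<bullet> v = y \<bullet> v" for k y
    proof -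
      have k: "\<gamma> k \<in> carrier G" using \<gamma> by auto
      then have "U (\<gamma> k) v = v" using assms(3) by (simp add: fixed_space_def)
      then show ?thesis using rep_inner[OF grp U_hom k, of y v] by simp
    qed
    then show ?thesis by (simp add: coorbit_piece_def)
  qed
  then show ?thesis using assms(1,2) by (auto simp: coorbit_pieces_def)
qed

lemma coorbit_map_piece: "\<exists>A\<in>coorbit_pieces. coorbit_map G U w e x = A x"
proof -
  have "\<exists>g\<in>carrier G. coorbit_map G U w e x $ k = U g (w (snd (e k))) \<bullet> x" for k
  proof -
    let ?xs = "rev (sorted_list_of_multiset (image_mset (\<lambda>g. U g (w (snd (e k))) \<bullet> x) (mset_set (carrier G))))"
    have "length ?xs = card (carrier G)"
      by (metis length_rev mset_sorted_list_of_multiset size_image_mset size_mset size_mset_set)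
    then have "fst (e k) - 1 < length ?xs" using rank_range[of k] by auto
    then have "?xs ! (fst (e k) - 1) \<in> set ?xs" by (rule nth_mem)
    also have "set ?xs = (\<lambda>g. U g (w (snd (e k))) \<bullet> x) ` carrier G"
      using fin by (simp only: set_rev set_sorted_list_of_multiset set_image_mset finite_set_mset_mset_set)
    finally show ?thesis by (auto simp: coorbit_map_def coorbit_def split: prod.split)
  qed
  then obtain \<gamma> where \<gamma>: "\<And>k. \<gamma> k \<in> carrier G"
      "\<And>k. coorbit_map G U w e x $ k = U (\<gamma> k) (w (snd (e k))) \<bullet> x"
    by metis
  show ?thesis
  proof
    show "coorbit_map G U w e x = coorbit_piece \<gamma> x"
      unfolding coorbit_piece_def vec_eq_iff by (simp add: \<gamma>(2))
    show "coorbit_piece \<gamma> \<in> coorbit_pieces"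
      unfolding coorbit_pieces_def by (intro imageI PiE_I \<gamma>(1)) simp
  qed
qed

lemma coorbit_map_lipschitz:
  "norm (coorbit_map G U w e x - coorbit_map G U w e y) \<le> (\<Sum>k\<in>UNIV. norm (w (snd (e k)))) * norm (x - y)"
proof -
  have "\<bar>(coorbit_map G U w e x - coorbit_map G U w e y) $ k\<bar> \<le> norm (w (snd (e k))) * norm (x - y)" for k
  proof -
    let ?w = "w (snd (e k))"
    have j: "1 \<le> fst (e k)" "fst (e k) \<le> card (carrier G)" using rank_range[of k] by auto
    have map: "coorbit_map G U w e z $ k = coorbit G U ?w (fst (e k)) z" for z
      by (simp add: coorbit_map_def split: prod.split)
    have "\<bar>U g ?w \<bullet> x - U g ?w \<bullet> y\<bar> \<le> norm ?w * norm (x - y)" if "g \<in> carrier G" for g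
      using Cauchy_Schwarz_ineq2[of "U g ?w" "x - y"] rep_norm[OF grp U_hom that]
      by (simp add: inner_diff_right)
    then show ?thesis
      unfolding vector_minus_component map coorbit_eq_sorted_nth[OF fin j]
      using j by (intro sorted_family_nth_perturb[OF fin]) auto
  qed
  then have "(\<Sum>k\<in>UNIV. \<bar>(coorbit_map G U w e x - coorbit_map G U w e y) $ k\<bar>) \<le>
      (\<Sum>k\<in>UNIV. norm (w (snd (e k))) * norm (x - y))" by (intro sum_mono)
  then show ?thesis
    using norm_le_l1_cart[of "coorbit_map G U w e x - coorbit_map G U w e y"]
    by (simp add: sum_distrib_right)
qed

lemma continuous_coorbit_map: "continuous_on A (coorbit_map G U w e)"
proof (rule lipschitz_on_continuous_on)
  show "(\<Sum>k\<in>UNIV. norm (w (snd (e k))))-lipschitz_on A (coorbit_map G U w e)"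
    using coorbit_map_lipschitz by (auto intro!: lipschitz_onI sum_nonneg simp: dist_norm)
qed

lemma piecewise_linear_difference:
  fixes L :: "real ^ 'm ^ 'n"
  shows "piecewise_linear (\<lambda>(x, y). L *v coorbit_map G U w e x - L *v coorbit_map G U w e y)"
  unfolding piecewise_linear_def
proof (intro conjI exI)
  have "continuous_on UNIV (\<lambda>p. L *v coorbit_map G U w e (fst p) - L *v coorbit_map G U w e (snd p))"
    by (intro continuous_on_diff linear_continuous_on_compose[OF _ matrix_vector_mul_linear]
          continuous_on_compose2[OF continuous_coorbit_map] continuous_intros) auto
  then show "continuous_on UNIV (\<lambda>(x, y). L *v coorbit_map G U w e x - L *v coorbit_map G U w e y)"
    by (simp add: case_prod_unfold)
  let ?\<A> = "(\<lambda>(A, B) p. L *v A (fst p) - L *v B (snd p)) ` (coorbit_pieces \<times> coorbit_pieces)"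
  show "finite ?\<A>" using finite_coorbit_pieces by simp
  show "\<forall>A\<in>?\<A>. linear A"
    by (auto intro!: linearI
        simp: linear_add[OF linear_coorbit_pieces] linear_scale[OF linear_coorbit_pieces]
          matrix_vector_right_distrib matrix_vector_mult_scaleR algebra_simps)
  show "\<forall>p. \<exists>A\<in>?\<A>. (case p of (x, y) \<Rightarrow> L *v coorbit_map G U w e x - L *v coorbit_map G U w e y) = A p"
  proof
    fix p :: "'a \<times> 'a"
    obtain x y where p: "p = (x, y)" by (cases p)
    obtain A B where "A \<in> coorbit_pieces" "B \<in> coorbit_pieces"
      "coorbit_map G U w e x = A x" "coorbit_map G U w e y = B y"
      using coorbit_map_piece by meson
    then show "\<exists>A\<in>?\<A>. (case p of (x, y) \<Rightarrow> L *v coorbit_map G U w e x - L *v coorbit_map G U w e y) = A p"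
      by (intro bexI[of _ "\<lambda>p. L *v A (fst p) - L *v B (snd p)"]) (auto simp: p)
  qed
qed

text \<open>Rank-nullity on \<open>\<V> \<times> \<V>\<close>, whose diagonal over the fixed space lies in the kernel.\<close>
lemma subspace_dim_piece_differences:
  assumes "A \<in> coorbit_pieces" "B \<in> coorbit_pieces"
  shows "subspace (range (\<lambda>(x, y). A x - B y))"
    and "dim (range (\<lambda>(x, y). A x - B y)) \<le> 2 * DIM('a) - dim (fixed_space G U)"
proof -
  have lin: "linear (\<lambda>(x, y). A x - B y)"
    using assms by (auto intro!: linearI
        simp: linear_add[OF linear_coorbit_pieces] linear_scale[OF linear_coorbit_pieces] algebra_simps)
  then show "subspace (range (\<lambda>(x, y). A x - B y))"
    using linear_subspace_image subspace_UNIV by blast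
  have diag: "linear (\<lambda>v :: 'a. (v, v))" by (auto intro!: linearI)
  have "dim (range (\<lambda>(x, y). A x - B y)) + dim ((\<lambda>v. (v, v)) ` fixed_space G U) \<le> DIM('a \<times> 'a)"
    using coorbit_pieces_fixed[OF assms] by (intro dim_range_le_codim[OF lin]) auto
  moreover have "dim ((\<lambda>v. (v, v)) ` fixed_space G U) = dim (fixed_space G U)"
    by (rule dim_image_eq[OF diag]) (auto simp: inj_on_def)
  ultimately show "dim (range (\<lambda>(x, y). A x - B y)) \<le> 2 * DIM('a) - dim (fixed_space G U)"
    by simp
qed

lemma orbit_dist_le:
  assumes "g \<in> carrier G"
  shows "orbit_dist G U (orbit G U x) (orbit G U y) \<le> norm (x - U g y)"
  unfolding orbit_dist_orbit[OF grp U_hom]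
  using fin assms by (intro Min_le) auto

lemma orbit_dist_attained:
  obtains g where "g \<in> carrier G" "orbit_dist G U (orbit G U x) (orbit G U y) = norm (x - U g y)"
proof -
  have "carrier G \<noteq> {}" using grp by (metis empty_iff group.is_monoid monoid.one_closed)
  then have "Min {norm (x - U g y) | g. g \<in> carrier G} \<in> {norm (x - U g y) | g. g \<in> carrier G}"
    using fin by (intro Min_in) auto
  then show thesis using that unfolding orbit_dist_orbit[OF grp U_hom] by blast
qed

lemma orbit_eqE:
  assumes "orbit G U x = orbit G U y"
  obtains g where "g \<in> carrier G" "x = U g y"
proof -
  have "x \<in> orbit G U x"
    using rep_one[OF grp U_hom] grp unfolding orbit_def
    by (metis (mono_tags, lifting) group.is_monoid mem_Collect_eq monoid.one_closed)
  then show thesis using assms that by (auto simp: orbit_def)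
qed

text \<open>
  Separation of orbits identifies the zeros of \<open>L (\<Phi> x) - L (\<Phi> y)\<close> as pairs \<open>(U g y', y')\<close>. Since
  \<open>U g\<close> is an isometry, replacing \<open>x\<close> by \<open>U g y'\<close> and \<open>y\<close> by \<open>y'\<close> bounds the orbit distance by
  \<open>norm (x - U g y') + norm (y - y')\<close>, which is where the factor 2 comes from.
\<close>
lemma bi_lipschitz_of_separating:
  fixes L :: "real ^ 'm ^ 'n"
  assumes sep: "\<And>x y. L *v coorbit_map G U w e x = L *v coorbit_map G U w e y \<Longrightarrow>
    orbit G U x = orbit G U y"
  shows "bi_lipschitz G U ((\<lambda>v. L *v v) \<circ> orbit_lift (coorbit_map G U w e))"
proof -
  let ?\<Phi> = "coorbit_map G U w e"
  let ?d = "\<lambda>x y. orbit_dist G U (orbit G U x) (orbit G U y)"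
  obtain a where a: "a > 0" and bound:
    "\<And>p. \<exists>z. (\<lambda>(x, y). L *v ?\<Phi> x - L *v ?\<Phi> y) z = 0 \<and>
      a * dist p z \<le> norm ((\<lambda>(x, y). L *v ?\<Phi> x - L *v ?\<Phi> y) p)"
    using piecewise_linear_error_bound[OF piecewise_linear_difference] by blast
  have lower: "a / 2 * ?d x y \<le> norm (L *v ?\<Phi> x - L *v ?\<Phi> y)" for x y
  proof -
    obtain x' y' where z: "L *v ?\<Phi> x' = L *v ?\<Phi> y'"
      "a * dist (x, y) (x', y') \<le> norm (L *v ?\<Phi> x - L *v ?\<Phi> y)"
      using bound[of "(x, y)"] by auto
    obtain g where g: "g \<in> carrier G" "x' = U g y'" using orbit_eqE[OF sep[OF z(1)]] .
    have "?d x y \<le> norm ((x - x') - (U g y - U g y'))" using orbit_dist_le[OF g(1), of x y] g(2) by simp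
    also have "\<dots> \<le> norm (x - x') + norm (U g y - U g y')" by (rule norm_triangle_ineq4)
    also have "norm (U g y - U g y') = norm (y - y')"
      using rep_norm[OF grp U_hom g(1), of "y - y'"] rep_linear[OF grp U_hom g(1)] by (simp add: linear_diff)
    also have "norm (x - x') + norm (y - y') \<le> 2 * dist (x, y) (x', y')"
      using dist_fst_le[of "(x, y)" "(x', y')"] dist_snd_le[of "(x, y)" "(x', y')"] by (simp add: dist_norm)
    finally have "a / 2 * ?d x y \<le> a / 2 * (2 * dist (x, y) (x', y'))"
      using a by (intro mult_left_mono) auto
    then show ?thesis using z(2) by simp
  qed
  obtain C where C: "\<And>v. norm (L *v v) \<le> C * norm v" "C > 0"
    using linear_bounded_pos[OF matrix_vector_mul_linear[of L]] by metis
  define b where "b = C * (\<Sum>k\<in>UNIV. norm (w (snd (e k))))"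
  have upper: "norm (L *v ?\<Phi> x - L *v ?\<Phi> y) \<le> b * ?d x y" for x y
  proof -
    obtain g where g: "g \<in> carrier G" "?d x y = norm (x - U g y)" using orbit_dist_attained .
    have inv: "?\<Phi> (U g y) = ?\<Phi> y"
      by (simp add: coorbit_map_def coorbit_invariant[OF grp U_hom g(1)] split: prod.split)
    have "norm (L *v ?\<Phi> x - L *v ?\<Phi> y) = norm (L *v (?\<Phi> x - ?\<Phi> (U g y)))"
      by (simp add: matrix_vector_mult_diff_distrib inv)
    also have "\<dots> \<le> C * norm (?\<Phi> x - ?\<Phi> (U g y))" by (rule C(1))
    also have "\<dots> \<le> C * ((\<Sum>k\<in>UNIV. norm (w (snd (e k)))) * norm (x - U g y))"
      using C(2) by (intro mult_left_mono coorbit_map_lipschitz) auto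
    finally show ?thesis by (simp add: b_def g(2))
  qed
  have "?d x y \<ge> 0" for x y using orbit_dist_attained[of x y] by (metis norm_ge_zero)
  then have "b * ?d x y \<le> max (a / 2) b * ?d x y" for x y by (intro mult_right_mono) auto
  then have upper': "norm (L *v ?\<Phi> x - L *v ?\<Phi> y) \<le> max (a / 2) b * ?d x y" for x y
    using upper order_trans by blast
  show ?thesis
    unfolding bi_lipschitz_def orbit_space_def
    by (rule exI[of _ "a / 2"], rule exI[of _ "max (a / 2) b"])
      (use a lower upper' in \<open>auto simp: orbit_lift_coorbit_map[OF grp U_hom]\<close>)
qed

end

theorem theorem1p6:
  fixes G :: "('g, 'b) monoid_scheme"
    and U :: "'g \<Rightarrow> 'a \<Rightarrow> 'a::euclidean_space"
    and N p d d\<^sub>G :: nat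
    and w :: "nat \<Rightarrow> 'a"
    and S :: "(nat \<times> nat) set"
    and e :: "'m::finite \<Rightarrow> nat \<times> nat"
  assumes "group G" and "finite (carrier G)" and "order G = N"
    and "U \<in> hom G linear_isometries"
    and "DIM('a) = d" and "d \<ge> 2"
    and "dim (fixed_space G U) = d\<^sub>G"
    and "S \<subseteq> {1..N} \<times> {1..p}"
    and "bij_betw e UNIV S"
    and "CARD('n::finite) = 2 * d - d\<^sub>G"
    and "inj_on (orbit_lift (coorbit_map G U w e)) (orbit_space G U)"
  shows "zariski_generic (\<lambda>L :: real ^ 'm ^ 'n.
           inj_on ((\<lambda>v. L *v v) \<circ> orbit_lift (coorbit_map G U w e)) (orbit_space G U) \<and>
           bi_lipschitz G U ((\<lambda>v. L *v v) \<circ> orbit_lift (coorbit_map G U w e)))"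
proof -
  note grp = assms(1) and fin = assms(2) and hom = assms(4)
  let ?\<Phi> = "coorbit_map G U w e"
  have rank: "range e \<subseteq> {1..card (carrier G)} \<times> UNIV"
    using assms(3,8,9) by (auto simp: bij_betw_def order_def)
  note ctx = grp hom fin rank
  define \<P> where "\<P> = coorbit_pieces G U w e"
  define E where "E = (\<lambda>(A, B). range (\<lambda>(x :: 'a, y :: 'a). A x - B y :: real ^ 'm))"
  have "\<exists>p. real_polynomial_function p \<and> (\<exists>L. p L \<noteq> 0) \<and>
      (\<forall>(L :: real ^ 'm ^ 'n) v. p L \<noteq> 0 \<longrightarrow> v \<in> E c \<longrightarrow> L *v v = 0 \<longrightarrow> v = 0)"
    if c: "c \<in> \<P> \<times> \<P>" for c
  proof -
    obtain A B where AB: "c = (A, B)" "A \<in> \<P>" "B \<in> \<P>" using c by auto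
    have E: "subspace (E c)" "dim (E c) \<le> CARD('n)"
      using subspace_dim_piece_differences[OF ctx AB(2,3)[unfolded \<P>_def]] AB(1) assms(5,7,10)
      by (auto simp: E_def)
    obtain p where "real_polynomial_function p" "\<exists>L. p L \<noteq> 0"
      "\<And>(L :: real ^ 'm ^ 'n) v. p L \<noteq> 0 \<Longrightarrow> v \<in> E c \<Longrightarrow> L *v v = 0 \<Longrightarrow> v = 0"
      by (rule injective_on_subspace_polynomial[OF E]) (rule that)
    then show ?thesis by blast
  qed
  then have "\<forall>c\<in>\<P> \<times> \<P>. \<exists>p. real_polynomial_function p \<and> (\<exists>L. p L \<noteq> 0) \<and>
      (\<forall>(L :: real ^ 'm ^ 'n) v. p L \<noteq> 0 \<longrightarrow> v \<in> E c \<longrightarrow> L *v v = 0 \<longrightarrow> v = 0)"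
    by (rule ballI)
  from bchoice[OF this] obtain P where
    P0: "\<forall>c\<in>\<P> \<times> \<P>. real_polynomial_function (P c) \<and> (\<exists>L. P c L \<noteq> 0) \<and>
      (\<forall>(L :: real ^ 'm ^ 'n) v. P c L \<noteq> 0 \<longrightarrow> v \<in> E c \<longrightarrow> L *v v = 0 \<longrightarrow> v = 0)"
    by (rule exE)
  have P: "real_polynomial_function (P c)" "\<exists>L. P c L \<noteq> 0"
    "P c L \<noteq> 0 \<Longrightarrow> v \<in> E c \<Longrightarrow> L *v v = 0 \<Longrightarrow> v = 0"
    if "c \<in> \<P> \<times> \<P>" for c v and L :: "real ^ 'm ^ 'n"
    using bspec[OF P0 that] by simp_all
  have "finite (\<P> \<times> \<P>)" unfolding \<P>_def using finite_coorbit_pieces[OF ctx] by simp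
  then have generic: "zariski_generic (\<lambda>L. \<forall>c\<in>\<P> \<times> \<P>. P c L \<noteq> 0)"
    using P(1,2) by (rule zariski_generic_nonzero)
  have good: "inj_on ((\<lambda>v. L *v v) \<circ> orbit_lift ?\<Phi>) (orbit_space G U) \<and>
      bi_lipschitz G U ((\<lambda>v. L *v v) \<circ> orbit_lift ?\<Phi>)"
    if L: "\<forall>c\<in>\<P> \<times> \<P>. P c L \<noteq> 0" for L
  proof -
    have sep: "orbit G U x = orbit G U y" if eq: "L *v ?\<Phi> x = L *v ?\<Phi> y" for x y
    proof -
      obtain A where A: "A \<in> \<P>" "?\<Phi> x = A x"
        unfolding \<P>_def using coorbit_map_piece[OF ctx, of w x] by (rule bexE)
      obtain B where B: "B \<in> \<P>" "?\<Phi> y = B y"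
        unfolding \<P>_def using coorbit_map_piece[OF ctx, of w y] by (rule bexE)
      have "?\<Phi> x - ?\<Phi> y \<in> E (A, B)"
        unfolding E_def A(2) B(2) by (simp, rule image_eqI[of _ _ "(x, y)"]) simp_all
      moreover have "L *v (?\<Phi> x - ?\<Phi> y) = 0" using eq by (simp add: matrix_vector_mult_diff_distrib)
      moreover have "(A, B) \<in> \<P> \<times> \<P>" using A(1) B(1) by blast
      ultimately have "?\<Phi> x - ?\<Phi> y = 0"
        using P(3)[of "(A, B)" L "?\<Phi> x - ?\<Phi> y"] L by simp
      then have "?\<Phi> x = ?\<Phi> y" by simp
      then have "orbit_lift ?\<Phi> (orbit G U x) = orbit_lift ?\<Phi> (orbit G U y)"
        by (simp add: orbit_lift_coorbit_map[OF grp hom])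
      then show ?thesis
        by (rule inj_onD[OF assms(11)]) (auto simp: orbit_space_def)
    qed
    have "inj_on ((\<lambda>v. L *v v) \<circ> orbit_lift ?\<Phi>) (orbit_space G U)"
    proof (rule inj_onI)
      fix X Y assume XY: "X \<in> orbit_space G U" "Y \<in> orbit_space G U"
        and eq: "((\<lambda>v. L *v v) \<circ> orbit_lift ?\<Phi>) X = ((\<lambda>v. L *v v) \<circ> orbit_lift ?\<Phi>) Y"
      obtain x y where "X = orbit G U x" "Y = orbit G U y"
        using XY by (auto simp: orbit_space_def)
      then show "X = Y" using eq sep[of x y] by (simp add: orbit_lift_coorbit_map[OF grp hom])
    qed
    moreover have "bi_lipschitz G U ((\<lambda>v. L *v v) \<circ> orbit_lift ?\<Phi>)"
      by (rule bi_lipschitz_of_separating[OF ctx sep])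
    ultimately show ?thesis by (rule conjI)
  qed
  show ?thesis
    using generic good unfolding zariski_generic_def by blast
qed

end
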